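(* $d_{K_5}(n)\ge \frac{1}{n^{o(1)}}$; that is, there is a function $\varepsilon(n)\to 0$ as $n\to\infty$ such that $d_{K_5}(n)\ge n^{-\varepsilon(n)}$ for all $n$.
   Context: For a graph $H$, a collection $\mathcal{F}$ of graphs on vertex set $[n]$ is an $H$-code if it contains no two members whose symmetric difference (as edge sets on $[n]$) is isomorphic to $H$. $D_H(n)$ is the maximum cardinality of an $H$-code on $[n]$, and $d_H(n)=D_H(n)/2^{\binom{n}{2}}$. *)

theory Defs
  imports Complex_Main "HOL-Library.Ramsey"
begin

(* A simple graph is a pair (V, E) with E \<subseteq> [V]\<^bsup>2\<^esup>, the set of
   two-element subsets of V.  A graph on the fixed vertex set {1..n} is
   identified with its edge set. *)
type_synonym 'a graph = "'a set \<times> 'a set set"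

definition graph_iso :: "'a graph \<Rightarrow> 'b graph \<Rightarrow> bool" where
  "graph_iso G H \<longleftrightarrow>
     (\<exists>f. bij_betw f (fst G) (fst H) \<and>
          (\<forall>u\<in>fst G. \<forall>v\<in>fst G. {u, v} \<in> snd G \<longleftrightarrow> {f u, f v} \<in> snd H))"

definition complete_graph :: "nat \<Rightarrow> nat graph" where
  "complete_graph m = ({1..m}, [{1..m}]\<^bsup>2\<^esup>)"

(* S is the edge set of a copy of H inside the complete graph on {1..n}.  The
   vertices of {1..n} outside the copy are isolated and are disregarded, so H
   may have fewer than n vertices. *)
definition is_copy_on :: "nat \<Rightarrow> 'a graph \<Rightarrow> nat set set \<Rightarrow> bool" where
  "is_copy_on n H S \<longleftrightarrow>
     (\<exists>W\<subseteq>{1..n}. S \<subseteq> [W]\<^bsup>2\<^esup> \<and> graph_iso (W, S) H)"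

definition graph_code :: "'a graph \<Rightarrow> nat \<Rightarrow> nat set set set \<Rightarrow> bool" where
  "graph_code H n F \<longleftrightarrow>
     F \<subseteq> Pow ([{1..n}]\<^bsup>2\<^esup>) \<and>
     (\<forall>A\<in>F. \<forall>B\<in>F. A \<noteq> B \<longrightarrow> \<not> is_copy_on n H (sym_diff A B))"

(* The set is finite and contains 0 (empty code), so Max is well defined. *)
definition max_code :: "'a graph \<Rightarrow> nat \<Rightarrow> nat" where
  "max_code H n = Max {card F | F. graph_code H n F}"

definition code_density :: "'a graph \<Rightarrow> nat \<Rightarrow> real" where
  "code_density H n = real (max_code H n) / 2 ^ (n choose 2)"

end

theory Submission
  imports Defs "HOL-Library.FuncSet" "HOL-Real_Asymp.Real_Asymp"
begin

text \<open>Identify the vertices with words \<open>x\<close> of length \<open>t\<close> over an alphabet of size \<open>m\<close>.  Colour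
  an edge \<open>x y\<close> by the first coordinate \<open>d\<close> in which the words differ, the pair \<open>{x d, y d}\<close>, and,
  for every coordinate \<open>k\<close>, the sign of \<open>y k - x k\<close> relative to that of \<open>y d - x d\<close>.  Among any five
  vertices some edge then has a colour of its own.  For \<open>t\<close> about the square root of \<open>log 2 n\<close> and
  \<open>m = 2 ^ t\<close> the number of colours is \<open>2 ^ O(t)\<close>.  A colouring with \<open>k\<close> colours such that every
  copy of the clique has a unique colour gives a code of density at least \<open>(k + 1) ^ (-10)\<close>.\<close>

section \<open>A colouring in which every five points span an edge of unique colour\<close>

definition first_diff :: "(nat \<Rightarrow> 'a) \<Rightarrow> (nat \<Rightarrow> 'a) \<Rightarrow> nat" where
  "first_diff x y = (LEAST k. x k \<noteq> y k)"

lemma first_diff_commute: "first_diff x y = first_diff y x"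
  by (simp add: first_diff_def eq_commute)

lemma first_diff_neq: "x \<noteq> y \<Longrightarrow> x (first_diff x y) \<noteq> y (first_diff x y)"
  unfolding first_diff_def by (rule LeastI_ex) auto

lemma eq_below_first_diff: "k < first_diff x y \<Longrightarrow> x k = y k"
  unfolding first_diff_def using not_less_Least by blast

lemma first_diff_eqI: "x k \<noteq> y k \<Longrightarrow> (\<And>i. i < k \<Longrightarrow> x i = y i) \<Longrightarrow> first_diff x y = k"
  unfolding first_diff_def by (rule Least_equality) (auto simp: not_less[symmetric])

text \<open>The words \<open>x\<close> and \<open>y\<close> still agree where \<open>x\<close> and
  \<open>z\<close> split, so \<open>z\<close> leaves both at that place. By this ultrametric law the
  levels of a few edges determine those of the others.\<close>

lemma first_diff_isosceles:
  assumes "x \<noteq> z" "first_diff x z < first_diff x y"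
  shows "first_diff y z = first_diff x z"
  using assms first_diff_neq[of x z] eq_below_first_diff[of _ x y] eq_below_first_diff[of _ x z]
  by (intro first_diff_eqI) (metis less_trans)+

text \<open>Swapping \<open>x\<close> and \<open>y\<close> changes the sign of both factors, so the
  colour belongs to the unordered edge. Restricting the sign vector to \<open>{..<t}\<close> leaves
  only finitely many such vectors.\<close>

definition edge_colour ::
    "nat \<Rightarrow> (nat \<Rightarrow> int) \<Rightarrow> (nat \<Rightarrow> int) \<Rightarrow> nat \<times> int set \<times> (nat \<Rightarrow> int)" where
  "edge_colour t x y =
     (let d = first_diff x y
      in (d, {x d, y d}, \<lambda>k\<in>{..<t}. sgn ((y k - x k) * (y d - x d))))"

lemma edge_colour_commute: "edge_colour t x y = edge_colour t y x"
proof -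
  have "(y k - x k) * (y d - x d) = (x k - y k) * (x d - y d)" for k d
    by (simp add: algebra_simps)
  then show ?thesis
    by (simp add: edge_colour_def Let_def first_diff_commute[of y x] insert_commute)
qed

lemma edge_colour_eqD:
  assumes "edge_colour t x y = edge_colour t u v"
  shows "first_diff x y = first_diff u v"
    and "{x (first_diff x y), y (first_diff x y)} = {u (first_diff u v), v (first_diff u v)}"
    and "k < t \<Longrightarrow> sgn ((y k - x k) * (y (first_diff x y) - x (first_diff x y))) =
                  sgn ((v k - u k) * (v (first_diff u v) - u (first_diff u v)))"
  using assms by (auto simp: edge_colour_def Let_def restrict_def fun_eq_iff split: if_splits)

lemma edge_colour_neqI:
  "first_diff x y \<noteq> first_diff u v \<Longrightarrow> edge_colour t x y \<noteq> edge_colour t u v"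
  "{x (first_diff x y), y (first_diff x y)} \<noteq> {u (first_diff u v), v (first_diff u v)} \<Longrightarrow>
     edge_colour t x y \<noteq> edge_colour t u v"
  using edge_colour_eqD(1,2) by blast+

section \<open>Five points always span an edge of unique colour\<close>

definition uniquely_coloured :: "('a \<Rightarrow> 'a \<Rightarrow> 'c) \<Rightarrow> 'a set \<Rightarrow> 'a \<Rightarrow> 'a \<Rightarrow> bool" where
  "uniquely_coloured c S x y \<longleftrightarrow>
     x \<in> S \<and> y \<in> S \<and> x \<noteq> y \<and>
     (\<forall>u\<in>S. \<forall>v\<in>S. u \<noteq> v \<longrightarrow> c u v = c x y \<longrightarrow> {u, v} = {x, y})"

text \<open>Listing the ten edges in one orientation each turns the search for an edge of equal
  colour into a finite case distinction; symmetry of \<open>c\<close> allows the orientation to be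
  fixed.\<close>

lemma five_points_partner:
  assumes dist: "distinct [x1, x2, x3, x4, x5]" and S: "S = {x1, x2, x3, x4, x5}"
    and commute: "\<And>x y. c x y = c y x"
    and none: "\<not> uniquely_coloured c S x y" and xy: "x \<in> S" "y \<in> S" "x \<noteq> y"
  shows "\<exists>(u, v) \<in> {(x1, x2), (x1, x3), (x1, x4), (x1, x5), (x2, x3), (x2, x4), (x2, x5),
           (x3, x4), (x3, x5), (x4, x5)}. c u v = c x y \<and> {u, v} \<noteq> {x, y}"
    (is "\<exists>(u, v) \<in> ?P. ?Q u v")
proof -
  obtain u v where uv: "u \<in> S" "v \<in> S" "u \<noteq> v" "?Q u v"
    using none xy unfolding uniquely_coloured_def by auto
  then have "?Q v u"
    using commute[of u v] by (simp add: insert_commute)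
  moreover have "(u, v) \<in> ?P \<or> (v, u) \<in> ?P"
    using uv(1-3) unfolding S by (elim insertE emptyE) simp_all
  ultimately show ?thesis
    using uv(4) by blast
qed

text \<open>The edges between the two pairs, and those from \<open>x3\<close>, \<open>x4\<close> to
  \<open>x5\<close>, agree in level \<open>i\<close> and in their values there, so only signs can
  separate them. At coordinate \<open>j\<close> the signs of \<open>x1 x4\<close> and
  \<open>x2 x3\<close> are opposite and nonzero, yet both would have to equal the common sign of
  \<open>x3 x5\<close> and \<open>x4 x5\<close>.\<close>

lemma five_points_core:
  assumes S: "S = {x1, x2, x3, x4, x5}" and dist: "distinct [x1, x2, x3, x4, x5]"
    and d: "first_diff x1 x2 = j" "first_diff x3 x4 = j" "first_diff x1 x3 = i"
      "first_diff x3 x5 = i" "i < j" "first_diff x1 x5 < j" "j < t"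
    and vals: "x1 j = x3 j" "x2 j = x4 j" "x5 i = x1 i"
    and none: "\<And>x y. \<not> uniquely_coloured (edge_colour t) S x y"
  shows False
proof -
  define k where "k = first_diff x1 x5"
  have d2: "first_diff x2 x3 = i" "first_diff x2 x5 = k" "first_diff x1 x5 = k" "k < j"
    using first_diff_isosceles[of x1 x3 x2] first_diff_isosceles[of x1 x5 x2] d dist
    by (auto simp: k_def)
  have d3: "first_diff x1 x4 = i" "first_diff x4 x5 = i"
    using first_diff_isosceles[of x3 x1 x4] first_diff_isosceles[of x3 x5 x4] d dist
    by (auto simp: first_diff_commute)
  have d4: "first_diff x2 x4 = i"
    using first_diff_isosceles[of x1 x4 x2] d d3 dist by auto
  have v: "x2 i = x1 i" "x4 i = x3 i" "x2 k = x1 k"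
    using eq_below_first_diff[of _ x1 x2] eq_below_first_diff[of _ x3 x4] d d2 by auto
  have ne: "x1 i \<noteq> x3 i" "x1 k \<noteq> x5 k" "x1 j \<noteq> x2 j"
    using first_diff_neq[of x1 x3] first_diff_neq[of x1 x5] first_diff_neq[of x1 x2] dist d
    by (auto simp: k_def)
  \<comment> \<open>With \<open>k < j\<close> this leaves \<open>x1 x5\<close> and
    \<open>x2 x5\<close> as the only edges at level \<open>k\<close>.\<close>
  have "k \<noteq> i" using ne vals by auto
  note fd = d(1-4) d2(1-3) d3 d4
  note partner = five_points_partner[OF dist S edge_colour_commute none]
  have lvl: "edge_colour t x y \<noteq> edge_colour t u v" if "first_diff x y \<noteq> first_diff u v" for x y u v
    using edge_colour_eqD(1) that by blast
  \<comment> \<open>The entry of the sign vector at coordinate \<open>j\<close>. For edges that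
    split at \<open>i\<close> or \<open>k\<close> it carries information beyond the level and the
    values there.\<close>
  define s where "s x y = sgn ((y j - x j) * (y (first_diff x y) - x (first_diff x y)))" for x y :: "nat \<Rightarrow> int"
  have sD: "s x y = s u v" if "edge_colour t x y = edge_colour t u v" for x y u v
    unfolding s_def by (rule edge_colour_eqD(3)[OF that \<open>j < t\<close>])
  have sgns: "s x1 x4 = sgn (x2 j - x1 j) * sgn (x3 i - x1 i)"
    "s x2 x3 = sgn (x1 j - x2 j) * sgn (x3 i - x1 i)"
    "s x1 x3 = 0" "s x2 x4 = 0"
    "s x3 x5 = sgn (x5 j - x1 j) * sgn (x1 i - x3 i)"
    "s x4 x5 = sgn (x5 j - x2 j) * sgn (x1 i - x3 i)"
    "s x1 x5 = sgn (x5 j - x1 j) * sgn (x5 k - x1 k)"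
    "s x2 x5 = sgn (x5 j - x2 j) * sgn (x5 k - x1 k)"
    using vals v by (auto simp: s_def fd sgn_mult)
  have nz: "s x1 x4 \<noteq> 0" "s x2 x3 \<noteq> 0" "s x1 x4 \<noteq> s x2 x3"
    using ne unfolding sgns by (auto simp: sgn_if)
  \<comment> \<open>Alone at level \<open>k\<close>, the two edges must be each other's partners.
    Comparing their signs puts \<open>x5 j\<close> on the same side of \<open>x1 j\<close> and of
    \<open>x2 j\<close>.\<close>
  have "edge_colour t x2 x5 = edge_colour t x1 x5"
    using partner[of x1 x5] dist S \<open>k \<noteq> i\<close> d(5) d2(4) by (auto simp: fd lvl doubleton_eq_iff)
  from sD[OF this] have "sgn (x5 j - x2 j) = sgn (x5 j - x1 j)"
    using ne(2) by (auto simp: sgns sgn_0_0)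
  then have eq: "s x4 x5 = s x3 x5"
    by (simp add: sgns)
  \<comment> \<open>Among the edges at level \<open>i\<close>, \<open>x1 x3\<close> and
    \<open>x2 x4\<close> have sign 0 and \<open>x2 x3\<close> has the opposite sign, so the partner
    is \<open>x3 x5\<close> or \<open>x4 x5\<close>.\<close>
  have "s x1 x4 = s x3 x5"
    using partner[of x1 x4] dist S \<open>k \<noteq> i\<close> d(5) d2(4) nz sgns(3,4) eq
    by (auto simp: fd lvl doubleton_eq_iff dest!: sD)
  moreover have "s x2 x3 = s x3 x5"
    using partner[of x2 x3] dist S \<open>k \<noteq> i\<close> d(5) d2(4) nz sgns(3,4) eq
    by (auto simp: fd lvl doubleton_eq_iff dest!: sD)
  ultimately show False
    using nz by simp
qed

text \<open>Take a deepest pair \<open>x1, x2\<close>.  An edge of the same colour is disjoint from it, as two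
  edges \<open>x1 x2\<close> and \<open>x1 x3\<close> of the same colour would force \<open>x2\<close> and \<open>x3\<close> to split even later.\<close>

lemma five_points_unique_colour:
  assumes "card S = 5" and ext: "S \<subseteq> extensional {..<t}"
  shows "\<exists>x y. uniquely_coloured (edge_colour t) S x y"
proof (rule ccontr)
  assume "\<nexists>x y. uniquely_coloured (edge_colour t) S x y"
  then have none: "\<not> uniquely_coloured (edge_colour t) S x y" for x y by blast
  have "finite S" using assms by (simp add: card_ge_0_finite)
  define P where "P = {(x, y). x \<in> S \<and> y \<in> S \<and> x \<noteq> y}"
  have "finite P"
    by (rule finite_subset[of _ "S \<times> S"]) (auto simp: P_def \<open>finite S\<close>)
  moreover have "P \<noteq> {}"
  proof
    assume "P = {}"
    then have "card S \<le> 1" using \<open>finite S\<close> by (auto simp: P_def card_le_Suc0_iff_eq)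
    then show False using assms by simp
  qed
  ultimately have "Max (case_prod first_diff ` P) \<in> case_prod first_diff ` P"
    by (intro Max_in) auto
  then obtain p where p: "p \<in> P" "Max (case_prod first_diff ` P) = case_prod first_diff p"
    by auto
  obtain x1 x2 where "p = (x1, x2)" by (cases p)
  with p have x12: "x1 \<in> S" "x2 \<in> S" "x1 \<noteq> x2" by (auto simp: P_def)
  define j where "j = first_diff x1 x2"
  have deepest: "first_diff x y \<le> j" if "x \<in> S" "y \<in> S" "x \<noteq> y" for x y
  proof -
    have "first_diff x y \<in> case_prod first_diff ` P"
      using that by (intro image_eqI[of _ _ "(x, y)"]) (auto simp: P_def)
    then have "first_diff x y \<le> Max (case_prod first_diff ` P)"
      using \<open>finite P\<close> by (intro Max_ge) auto
    then show ?thesis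
      using p(2) \<open>p = (x1, x2)\<close> by (simp add: j_def)
  qed
  \<comment> \<open>Both words are \<open>undefined\<close> from coordinate \<open>t\<close> on and
    cannot first differ there.\<close>
  have "j < t"
    using first_diff_neq[of x1 x2] ext x12 unfolding j_def extensional_def
    by (metis (mono_tags, lifting) in_mono lessThan_iff mem_Collect_eq)
  \<comment> \<open>With equal values at \<open>j\<close>, two points that leave \<open>z\<close>
    there would agree up to and including \<open>j\<close> and split later, against the choice of
    \<open>j\<close>.\<close>
  have same: "x j \<noteq> y j" if "x \<in> S" "y \<in> S" "x \<noteq> y" "first_diff x z = j" "first_diff y z = j" for x y z
  proof
    assume "x j = y j"
    have "first_diff x y \<le> j" using deepest that by blast
    moreover have "first_diff x y \<noteq> j"
      using first_diff_neq[of x y] that \<open>x j = y j\<close> by metis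
    ultimately have "first_diff x y < j" by simp
    then have "x (first_diff x y) = y (first_diff x y)"
      using eq_below_first_diff[of _ x z] eq_below_first_diff[of _ y z] that by auto
    then show False using first_diff_neq that by blast
  qed
  obtain x3 x4 where x34: "x3 \<in> S" "x4 \<in> S" "x3 \<noteq> x4" "first_diff x3 x4 = j"
      "x3 j = x1 j" "x4 j = x2 j" "{x3, x4} \<noteq> {x1, x2}"
  proof -
    obtain u v where uv: "u \<in> S" "v \<in> S" "u \<noteq> v" "edge_colour t u v = edge_colour t x1 x2"
        "{u, v} \<noteq> {x1, x2}"
      using none[of x1 x2] x12 unfolding uniquely_coloured_def by auto
    have "first_diff u v = j" "{u j, v j} = {x1 j, x2 j}"
      using edge_colour_eqD(1,2)[OF uv(4)] by (auto simp: j_def)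
    then consider "u j = x1 j" "v j = x2 j" | "u j = x2 j" "v j = x1 j"
      by (auto simp: doubleton_eq_iff)
    then show thesis
    proof cases
      case 1
      then show thesis using that[of u v] uv \<open>first_diff u v = j\<close> by blast
    next
      case 2
      then show thesis using that[of v u] uv \<open>first_diff u v = j\<close>
        by (metis first_diff_commute insert_commute)
    qed
  qed
  have ne_j: "x1 j \<noteq> x2 j"
    using first_diff_neq[of x1 x2] x12 by (simp add: j_def)
  have "x3 \<noteq> x1"
    using same[of x4 x2 x1] x12 x34 by (metis first_diff_commute j_def)
  moreover have "x4 \<noteq> x2"
    using same[of x3 x1 x2] x12 x34 by (metis first_diff_commute j_def)
  moreover have "x3 \<noteq> x2" "x4 \<noteq> x1"
    using x34 ne_j by auto
  ultimately have dist4: "distinct [x1, x2, x3, x4]"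
    using x12 x34 by auto
  have "card (S - {x1, x2, x3, x4}) = 1"
    using assms dist4 x12 x34 \<open>finite S\<close> by (subst card_Diff_subset) auto
  then obtain x5 where "S - {x1, x2, x3, x4} = {x5}"
    by (auto simp: card_1_singleton_iff)
  then have S: "S = {x1, x2, x3, x4, x5}" and "distinct [x1, x2, x3, x4, x5]"
    using x12 x34 dist4 by auto
  note dist = this(2)
  define i where "i = first_diff x1 x3"
  have "i < j"
    using deepest[of x1 x3] first_diff_neq[of x1 x3] dist x12 x34
    by (metis distinct_length_2_or_more i_def order_le_less)
  have fd: "first_diff x1 x2 = j" "first_diff x3 x4 = j" "first_diff x1 x3 = i"
      "first_diff x2 x3 = i" "first_diff x1 x4 = i"
    using first_diff_isosceles[of x1 x3 x2] first_diff_isosceles[of x3 x1 x4] dist x34 \<open>i < j\<close>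
    by (auto simp: i_def j_def first_diff_commute)
  have fd24: "first_diff x2 x4 = i"
    using first_diff_isosceles[of x1 x4 x2] fd dist \<open>i < j\<close> by auto
  \<comment> \<open>Stated for arbitrary names because it is applied to both pairs. If
    \<open>y1 y5\<close> split at level \<open>j\<close>, then \<open>y1\<close>, \<open>y2\<close>,
    \<open>y5\<close> would have three distinct values there, and no other edge at that level would
    have the values of \<open>y1 y5\<close>.\<close>
  have far: "first_diff y1 y5 < j"
    if y: "S = {y1, y2, y3, y4, y5}" "distinct [y1, y2, y3, y4, y5]"
      "first_diff y1 y2 = j" "first_diff y3 y4 = j" "first_diff y1 y3 = i"
      "first_diff y2 y3 = i" "first_diff y1 y4 = i" "first_diff y2 y4 = i"
      "y1 j = y3 j" "y2 j = y4 j"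
    for y1 y2 y3 y4 y5
  proof (rule ccontr)
    assume "\<not> first_diff y1 y5 < j"
    then have y15: "first_diff y1 y5 = j"
      using deepest[of y1 y5] y(1,2) by auto
    have fy5: "first_diff y3 y5 = i" "first_diff y4 y5 = i"
      using first_diff_isosceles[of y1 y3 y5] first_diff_isosceles[of y1 y4 y5] y15 y \<open>i < j\<close>
      by (auto simp: first_diff_commute)
    have y52: "y5 j \<noteq> y2 j"
      using same[of y5 y2 y1] y y15 by (auto simp: first_diff_commute)
    have fy25: "first_diff y2 y5 = j"
      using y52 eq_below_first_diff[of _ y1 y2] eq_below_first_diff[of _ y1 y5] y(3) y15
      by (intro first_diff_eqI) auto
    have y1j: "y1 j \<noteq> y2 j" "y1 j \<noteq> y5 j"
      using first_diff_neq[of y1 y2] first_diff_neq[of y1 y5] y y15 by auto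
    have "y1 \<in> S" "y5 \<in> S" "y1 \<noteq> y5"
      using y(1,2) by auto
    from five_points_partner[OF y(2,1) edge_colour_commute none this] show False
      using y(2) y1j y52 \<open>i < j\<close>
      by (simp add: edge_colour_neqI doubleton_eq_iff y(3-8) y15 fy5 fy25 flip: y(9,10))
  qed
  have far15: "first_diff x1 x5 < j"
    using far[OF S dist] fd fd24 x34 by auto
  have far35: "first_diff x3 x5 < j"
    using far[of x3 x4 x1 x2 x5] S dist fd fd24 x34 by (auto simp: first_diff_commute)
  have x1234: "x2 i = x1 i" "x4 i = x3 i" "x1 i \<noteq> x3 i"
    using eq_below_first_diff[of i x1 x2] eq_below_first_diff[of i x3 x4] fd \<open>i < j\<close>
      first_diff_neq[of x1 x3] dist by auto
  have fd25: "first_diff x2 x5 = first_diff x1 x5" "first_diff x4 x5 = first_diff x3 x5"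
    using first_diff_isosceles[of x1 x5 x2] first_diff_isosceles[of x3 x5 x4] fd far15 far35 dist
    by auto
  \<comment> \<open>All these edges have level \<open>i\<close>; they are told apart by the sign at
    \<open>j\<close>, which is nonzero for \<open>x1 x4\<close>, opposite for \<open>x2 x3\<close>,
    and 0 for \<open>x1 x3\<close> and \<open>x2 x4\<close>.\<close>
  have diff: "edge_colour t x1 x4 \<noteq> edge_colour t x2 x3" "edge_colour t x1 x4 \<noteq> edge_colour t x1 x3"
    "edge_colour t x1 x4 \<noteq> edge_colour t x2 x4"
  proof -
    have neg: "sgn (x1 j - x2 j) = - sgn (x2 j - x1 j)"
      by (simp add: sgn_if)
    have "sgn ((x2 j - x1 j) * (x3 i - x1 i)) \<noteq> 0"
      "sgn ((x2 j - x1 j) * (x3 i - x1 i)) \<noteq> sgn ((x1 j - x2 j) * (x3 i - x1 i))"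
      using ne_j x1234(3) neg by (auto simp: sgn_mult sgn_0_0)
    then show "edge_colour t x1 x4 \<noteq> edge_colour t x2 x3"
      "edge_colour t x1 x4 \<noteq> edge_colour t x1 x3" "edge_colour t x1 x4 \<noteq> edge_colour t x2 x4"
      using edge_colour_eqD(3)[OF _ \<open>j < t\<close>, of x1 x4 x2 x3]
        edge_colour_eqD(3)[OF _ \<open>j < t\<close>, of x1 x4 x1 x3]
        edge_colour_eqD(3)[OF _ \<open>j < t\<close>, of x1 x4 x2 x4]
      unfolding fd fd24 x1234(1,2) x34(5,6) by auto
  qed
  \<comment> \<open>The colour of \<open>x1 x4\<close> can now recur only on an edge at
    \<open>x5\<close>. Such an edge has level \<open>i\<close> and values
    \<open>{x1 i, x3 i}\<close>, which forces \<open>x5 i\<close> to be one of the two.\<close>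
  have "(first_diff x3 x5 = i \<and> x5 i = x1 i) \<or> (first_diff x1 x5 = i \<and> x5 i = x3 i)"
  proof (rule ccontr)
    assume *: "\<not> ?thesis"
    have "x1 \<in> S" "x4 \<in> S" "x1 \<noteq> x4"
      using S dist by auto
    have "edge_colour t x1 x5 \<noteq> edge_colour t x1 x4" "edge_colour t x2 x5 \<noteq> edge_colour t x1 x4"
      "edge_colour t x3 x5 \<noteq> edge_colour t x1 x4" "edge_colour t x4 x5 \<noteq> edge_colour t x1 x4"
      using edge_colour_eqD(1,2)[of t x1 x5 x1 x4] edge_colour_eqD(1,2)[of t x2 x5 x1 x4]
        edge_colour_eqD(1,2)[of t x3 x5 x1 x4] edge_colour_eqD(1,2)[of t x4 x5 x1 x4] * x1234
      by (auto simp: fd fd25 doubleton_eq_iff)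
    with five_points_partner[OF dist S edge_colour_commute none \<open>x1 \<in> S\<close> \<open>x4 \<in> S\<close> \<open>x1 \<noteq> x4\<close>]
    show False
      using dist diff \<open>i < j\<close>
      by (simp add: edge_colour_neqI fd fd24 diff[symmetric])
  qed
  then show False
  proof
    assume "first_diff x3 x5 = i \<and> x5 i = x1 i"
    then show False
      using five_points_core[OF S dist, of j i t] none fd \<open>i < j\<close> \<open>j < t\<close> far15 x34 by auto
  next
    \<comment> \<open>The mirror image of the first case, with the pairs \<open>x1 x2\<close> and
      \<open>x3 x4\<close> exchanged.\<close>
    assume "first_diff x1 x5 = i \<and> x5 i = x3 i"
    moreover have "S = {x3, x4, x1, x2, x5}" "distinct [x3, x4, x1, x2, x5]"
      using S dist by auto
    ultimately show False
      using five_points_core[of S x3 x4 x1 x2 x5 j i t] none fd \<open>i < j\<close> \<open>j < t\<close> far35 x34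
      by (auto simp: first_diff_commute)
  qed
qed

section \<open>From colourings to codes\<close>

text \<open>Colour the points one after another: the earlier neighbours block fewer than
  \<open>D\<close> colours, so one is always free.\<close>

lemma greedy_colouring:
  fixes D :: nat
  assumes "finite V" and sym: "\<And>u v. R u v \<Longrightarrow> R v u"
    and deg: "\<And>v. v \<in> V \<Longrightarrow> card {u \<in> V. u \<noteq> v \<and> R u v} < D"
  shows "\<exists>c. (\<forall>v\<in>V. c v < D) \<and> (\<forall>u\<in>V. \<forall>v\<in>V. u \<noteq> v \<longrightarrow> R u v \<longrightarrow> c u \<noteq> c v)"
  using \<open>finite V\<close> deg
proof (induction V rule: finite_induct)
  case empty
  then show ?case by simp
next
  case (insert w V)
  have "card {u \<in> V. u \<noteq> v \<and> R u v} < D" if "v \<in> V" for v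
    using insert.prems[of v] insert.hyps(1) that
    by (intro order.strict_trans1[OF card_mono insert.prems[of v]]) auto
  from insert.IH[OF this] obtain c where c: "\<forall>v\<in>V. c v < D"
      "\<forall>u\<in>V. \<forall>v\<in>V. u \<noteq> v \<longrightarrow> R u v \<longrightarrow> c u \<noteq> c v"
    by blast
  define N where "N = {u \<in> V. u \<noteq> w \<and> R u w}"
  have "card (c ` N) \<le> card N"
    unfolding N_def using insert.hyps(1) by (intro card_image_le) auto
  also have "card N < D"
    unfolding N_def using insert.hyps(1)
    by (intro order.strict_trans1[OF card_mono insert.prems[of w]]) auto
  finally have "\<not> {..<D} \<subseteq> c ` N"
    using card_mono[of "c ` N" "{..<D}"] insert.hyps(1) by (auto simp: N_def)
  then obtain a where a: "a < D" "a \<notin> c ` N"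
    by auto
  have "\<forall>u\<in>V. R u w \<longrightarrow> c u \<noteq> a"
    using a insert.hyps(2) by (auto simp: N_def)
  then have "\<forall>u\<in>insert w V. \<forall>v\<in>insert w V. u \<noteq> v \<longrightarrow> R u v \<longrightarrow> (c(w := a)) u \<noteq> (c(w := a)) v"
    using c(2) sym insert.hyps(2) by (auto simp: eq_commute)
  moreover have "\<forall>v\<in>insert w V. (c(w := a)) v < D"
    using c(1) a(1) by auto
  ultimately show ?case by blast
qed

lemma card_small_subsets_le:
  assumes "finite C"
  shows "card {T \<in> Pow C. card T \<le> r} \<le> (card C + 1) ^ r"
proof -
  have "{T \<in> Pow C. card T \<le> r} = (\<Union>i\<in>{..r}. {T. T \<subseteq> C \<and> card T = i})"
    by auto
  then have "card {T \<in> Pow C. card T \<le> r} \<le> (\<Sum>i\<le>r. card {T. T \<subseteq> C \<and> card T = i})"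
    by (simp add: card_UN_le)
  also have "\<dots> = (\<Sum>i\<le>r. card C choose i)"
    using assms by (simp add: n_subsets)
  \<comment> \<open>The inserted factor is at least 1 for \<open>i \<le> r\<close> and completes the
    sum to a binomial expansion.\<close>
  also have "\<dots> \<le> (\<Sum>i\<le>r. (r choose i) * card C ^ i)"
  proof (rule sum_mono)
    fix i assume "i \<in> {..r}"
    then have "1 \<le> r choose i"
      by (simp add: Suc_le_eq)
    moreover have "card C choose i \<le> card C ^ i"
      by (cases "i \<le> card C") (simp_all add: binomial_le_pow binomial_eq_0)
    ultimately show "card C choose i \<le> (r choose i) * card C ^ i"
      using mult_le_mono by fastforce
  qed
  also have "\<dots> = (card C + 1) ^ r"
    using binomial[of "card C" 1 r] by simp
  finally show ?thesis .
qed

lemma card_nsets: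
  assumes "finite A"
  shows "card ([A]\<^bsup>k\<^esup>) = card A choose k"
proof -
  have "[A]\<^bsup>k\<^esup> = {B. B \<subseteq> A \<and> card B = k}"
    using assms finite_subset by (auto simp: nsets_def)
  then show ?thesis
    using n_subsets[OF assms] by simp
qed

text \<open>Common elements are counted twice in \<open>card A + card B\<close>. This parity rule
  makes the labels of graphs additive under symmetric difference.\<close>

lemma odd_card_sym_diff:
  assumes "finite A" "finite B"
  shows "odd (card (sym_diff A B)) \<longleftrightarrow> odd (card A) \<noteq> odd (card B)"
proof -
  have "card (sym_diff A B) + 2 * card (A \<inter> B) = card A + card B"
    using assms card_Diff_subset_Int[of A B] card_Diff_subset_Int[of B A]
      card_mono[of A "A \<inter> B"] card_mono[of B "A \<inter> B"]
    by (subst card_Un_disjoint) (auto simp: Int_commute)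
  then show ?thesis by presburger
qed

lemma card_le_max_code:
  assumes "graph_code H n F"
  shows "card F \<le> max_code H n"
proof -
  have "{card F | F. graph_code H n F} \<subseteq> card ` Pow (Pow ([{1..n}]\<^bsup>2\<^esup>))"
    by (auto simp: graph_code_def)
  then have "finite {card F | F. graph_code H n F}"
    by (rule finite_subset) (simp add: finite_imp_finite_nsets)
  then show ?thesis
    unfolding max_code_def using assms by (intro Max_ge) auto
qed

text \<open>The isomorphism sends any two distinct vertices of \<open>W\<close> to an edge of the
  complete graph, so no pair is missing from \<open>S\<close>.\<close>

lemma copy_of_complete_graph:
  assumes "is_copy_on n (complete_graph m) S"
  obtains W where "W \<subseteq> {1..n}" "card W = m" "S = [W]\<^bsup>2\<^esup>"
proof -
  obtain W f where W: "W \<subseteq> {1..n}" "S \<subseteq> [W]\<^bsup>2\<^esup>" and f: "bij_betw f W {1..m}"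
      and edges: "\<forall>u\<in>W. \<forall>v\<in>W. {u, v} \<in> S \<longleftrightarrow> {f u, f v} \<in> [{1..m}]\<^bsup>2\<^esup>"
    using assms by (auto simp: is_copy_on_def graph_iso_def complete_graph_def)
  have "[W]\<^bsup>2\<^esup> \<subseteq> S"
  proof
    fix e assume "e \<in> [W]\<^bsup>2\<^esup>"
    then obtain u v where "e = {u, v}" "u \<in> W" "v \<in> W" "u \<noteq> v"
      by (auto simp: nsets_2_eq)
    moreover from this have "f u \<noteq> f v" "f u \<in> {1..m}" "f v \<in> {1..m}"
      using bij_betwE[OF f] bij_betw_imp_inj_on[OF f] by (auto dest: inj_onD)
    ultimately show "e \<in> S"
      using edges by (simp del: atLeastAtMost_iff)
  qed
  then show thesis
    using that W f bij_betw_same_card[OF f] by auto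
qed

text \<open>Label a graph by the set of colours it uses an odd number of times.  If two graphs differ
  by a clique, their labels are distinct but differ in a bounded number of colours, so the labels
  can be properly coloured with few colours and the most popular class is a code.\<close>

lemma max_code_complete_graph_ge:
  fixes c :: "nat set \<Rightarrow> 'c"
  assumes "finite C" and cC: "\<And>e. e \<in> [{1..n}]\<^bsup>2\<^esup> \<Longrightarrow> c e \<in> C"
    and unique: "\<And>W. W \<subseteq> {1..n} \<Longrightarrow> card W = m \<Longrightarrow>
      \<exists>e\<in>[W]\<^bsup>2\<^esup>. \<forall>e'\<in>[W]\<^bsup>2\<^esup>. c e' = c e \<longrightarrow> e' = e"
  shows "2 ^ (n choose 2) \<le> max_code (complete_graph m) n * (card C + 1) ^ (m choose 2)"
proof -
  define r where "r = m choose 2"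
  define D where "D = (card C + 1) ^ r"
  define lab where "lab G = {\<gamma> \<in> C. odd (card {e \<in> G. c e = \<gamma>})}" for G
  define Gs where "Gs = Pow ([{1..n}]\<^bsup>2\<^esup>)"
  have fin: "finite ([{1..n}]\<^bsup>2\<^esup>)"
    by (simp add: finite_imp_finite_nsets)
  \<comment> \<open>Taking the symmetric difference with \<open>v\<close> maps the conflicting
    labels injectively to nonempty sets of at most \<open>r\<close> colours. Leaving out the empty
    set gives the strict inequality that greedy colouring requires.\<close>
  have "card {u \<in> Pow C. u \<noteq> v \<and> card (sym_diff u v) \<le> r} < D" if "v \<in> Pow C" for v
  proof -
    let ?T = "{T \<in> Pow C. card T \<le> r}"
    let ?U = "{u \<in> Pow C. u \<noteq> v \<and> card (sym_diff u v) \<le> r}"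
    have "inj_on (\<lambda>u. sym_diff u v) ?U"
      by (intro inj_onI) blast
    moreover have "(\<lambda>u. sym_diff u v) ` ?U \<subseteq> ?T - {{}}"
      using that by auto
    moreover have "finite ?T"
      using \<open>finite C\<close> by simp
    ultimately have "card ?U \<le> card (?T - {{}})"
      by (intro card_inj_on_le) auto
    also have "\<dots> < card ?T"
      using \<open>finite ?T\<close> by (rule card_Diff1_less) simp
    also have "\<dots> \<le> D"
      unfolding D_def by (rule card_small_subsets_le) fact
    finally show ?thesis .
  qed
  then obtain g where g: "\<forall>v\<in>Pow C. g v < D"
      "\<forall>u\<in>Pow C. \<forall>v\<in>Pow C. u \<noteq> v \<longrightarrow> card (sym_diff u v) \<le> r \<longrightarrow> g u \<noteq> g v"
    using greedy_colouring[of "Pow C" "\<lambda>u v. card (sym_diff u v) \<le> r" D] \<open>finite C\<close>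
    by (auto simp: Un_commute)
  define F where "F i = {G \<in> Gs. g (lab G) = i}" for i
  have code: "graph_code (complete_graph m) n (F i)" for i
    unfolding graph_code_def
  proof (intro conjI ballI impI notI)
    show "F i \<subseteq> Pow ([{1..n}]\<^bsup>2\<^esup>)"
      by (auto simp: F_def Gs_def)
  next
    fix A B assume AB: "A \<in> F i" "B \<in> F i" "A \<noteq> B"
      and copy: "is_copy_on n (complete_graph m) (sym_diff A B)"
    obtain W where W: "W \<subseteq> {1..n}" "card W = m" "sym_diff A B = [W]\<^bsup>2\<^esup>"
      by (rule copy_of_complete_graph[OF copy])
    have finAB: "finite A" "finite B"
      using AB fin by (auto simp: F_def Gs_def intro: finite_subset)
    have fW: "finite W"
      using W(1) finite_subset by blast
    \<comment> \<open>Since parities add, the two labels differ exactly in the colours used an odd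
      number of times on the clique.\<close>
    have lab: "sym_diff (lab A) (lab B) = {\<gamma> \<in> C. odd (card {e \<in> [W]\<^bsup>2\<^esup>. c e = \<gamma>})}"
    proof -
      have "{e \<in> [W]\<^bsup>2\<^esup>. c e = \<gamma>} = sym_diff {e \<in> A. c e = \<gamma>} {e \<in> B. c e = \<gamma>}" for \<gamma>
        unfolding W(3)[symmetric] by auto
      then show ?thesis
        using finAB by (auto simp: lab_def odd_card_sym_diff)
    qed
    obtain e where e: "e \<in> [W]\<^bsup>2\<^esup>" "\<forall>e'\<in>[W]\<^bsup>2\<^esup>. c e' = c e \<longrightarrow> e' = e"
      using unique[OF W(1,2)] by blast
    \<comment> \<open>A colour used exactly once is used an odd number of times, so the labels are
      distinct.\<close>
    then have "{e' \<in> [W]\<^bsup>2\<^esup>. c e' = c e} = {e}"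
      by auto
    moreover have "c e \<in> C"
      using e(1) nsets_mono[OF W(1)] cC by blast
    ultimately have "c e \<in> sym_diff (lab A) (lab B)"
      unfolding lab by simp
    then have "lab A \<noteq> lab B"
      by auto
    \<comment> \<open>Every colour in the difference occurs on the clique, which has only
      \<open>r\<close> edges.\<close>
    have "sym_diff (lab A) (lab B) \<subseteq> c ` [W]\<^bsup>2\<^esup>"
    proof
      fix \<gamma> assume "\<gamma> \<in> sym_diff (lab A) (lab B)"
      then have "odd (card {e \<in> [W]\<^bsup>2\<^esup>. c e = \<gamma>})"
        unfolding lab by simp
      then have "{e \<in> [W]\<^bsup>2\<^esup>. c e = \<gamma>} \<noteq> {}"
        by force
      then show "\<gamma> \<in> c ` [W]\<^bsup>2\<^esup>"
        by blast
    qed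
    then have "card (sym_diff (lab A) (lab B)) \<le> card ([W]\<^bsup>2\<^esup>)"
      using fW by (intro surj_card_le) (simp_all add: finite_imp_finite_nsets)
    also have "\<dots> = r"
      using fW W(2) by (simp add: card_nsets r_def)
    finally have "g (lab A) \<noteq> g (lab B)"
      using g(2) \<open>lab A \<noteq> lab B\<close> by (auto simp: lab_def)
    then show False
      using AB by (simp add: F_def)
  qed
  have le: "card (F i) \<le> max_code (complete_graph m) n" for i
    using code by (rule card_le_max_code)
  \<comment> \<open>Pigeonhole: \<open>D\<close> classes cover all graphs, and each class is a
    code.\<close>
  have "Gs \<subseteq> (\<Union>i\<in>{..<D}. F i)"
    using g(1) by (auto simp: F_def lab_def)
  moreover have "finite (\<Union>i\<in>{..<D}. F i)"
    using fin by (auto simp: F_def Gs_def)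
  ultimately have "card Gs \<le> card (\<Union>i\<in>{..<D}. F i)"
    by (intro card_mono)
  also have "\<dots> \<le> (\<Sum>i<D. card (F i))"
    by (intro card_UN_le) simp
  also have "\<dots> \<le> D * max_code (complete_graph m) n"
    using sum_bounded_above[of "{..<D}" "\<lambda>i. card (F i)", OF le] by simp
  finally have "card Gs \<le> D * max_code (complete_graph m) n" .
  moreover have "card ([{1..n}]\<^bsup>2\<^esup>) = n choose 2"
    by (simp add: card_nsets)
  then have "card Gs = 2 ^ (n choose 2)"
    using fin by (simp add: Gs_def card_Pow)
  ultimately show ?thesis
    by (simp add: D_def r_def mult.commute)
qed

section \<open>The number of colours and the choice of parameters\<close>

lemma edge_colours_finite_card:
  fixes X :: "(nat \<Rightarrow> int) set"
  assumes X: "X = {..<t} \<rightarrow>\<^sub>E {0..<int m}"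
  obtains C where "finite C" "card C \<le> t * (m\<^sup>2 * 3 ^ t)"
    "\<And>x y. x \<in> X \<Longrightarrow> y \<in> X \<Longrightarrow> x \<noteq> y \<Longrightarrow> edge_colour t x y \<in> C"
proof
  \<comment> \<open>Unordered pairs are images of ordered ones, whence the bound by the square of
    \<open>m\<close>.\<close>
  let ?pairs = "(\<lambda>(a, b). {a, b}) ` ({0..<int m} \<times> {0..<int m})"
  let ?signs = "{..<t} \<rightarrow>\<^sub>E {-1, 0, 1 :: int}"
  let ?C = "{..<t} \<times> ?pairs \<times> ?signs"
  show "finite ?C"
    by (intro finite_cartesian_product finite_imageI finite_PiE) auto
  have "card ?pairs \<le> m\<^sup>2"
    using card_image_le[of "{0..<int m} \<times> {0..<int m}" "\<lambda>(a, b). {a, b}"]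
    by (simp add: power2_eq_square)
  moreover have "card ?signs = 3 ^ t"
    by (simp add: card_funcsetE numeral_3_eq_3)
  ultimately show "card ?C \<le> t * (m\<^sup>2 * 3 ^ t)"
    by (simp only: card_cartesian_product card_lessThan mult_le_mono le_refl)
  show "edge_colour t x y \<in> ?C" if "x \<in> X" "y \<in> X" "x \<noteq> y" for x y
  proof -
    let ?d = "first_diff x y"
    have d: "?d < t"
    proof (rule ccontr)
      assume "\<not> ?d < t"
      then show False
        using first_diff_neq[OF that(3)] PiE_arb[of x _ _ ?d] PiE_arb[of y _ _ ?d] that(1,2) X by force
    qed
    then have "x ?d \<in> {0..<int m}" "y ?d \<in> {0..<int m}"
      using that(1,2) X by blast+
    then have "{x ?d, y ?d} \<in> ?pairs"
      by (intro image_eqI[of _ _ "(x ?d, y ?d)"]) auto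
    moreover have "(\<lambda>k\<in>{..<t}. sgn ((y k - x k) * (y ?d - x ?d))) \<in> ?signs"
      by (auto simp: sgn_if)
    ultimately show ?thesis
      using d by (simp add: edge_colour_def Let_def)
  qed
qed

lemma max_code_K5_ge:
  assumes "n \<le> m ^ t"
  shows "2 ^ (n choose 2) \<le> max_code (complete_graph 5) n * (t * (m\<^sup>2 * 3 ^ t) + 1) ^ 10"
proof -
  define X where "X = {..<t} \<rightarrow>\<^sub>E {0..<int m}"
  have "finite X" "card X = m ^ t"
    unfolding X_def by (auto intro: finite_PiE simp: card_funcsetE)
  then obtain p where p: "p ` {1..n} \<subseteq> X" "inj_on p {1..n}"
    using card_le_inj[of "{1..n}" X] assms by auto
  obtain C where C: "finite C" "card C \<le> t * (m\<^sup>2 * 3 ^ t)"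
    "\<And>x y. x \<in> X \<Longrightarrow> y \<in> X \<Longrightarrow> x \<noteq> y \<Longrightarrow> edge_colour t x y \<in> C"
    using edge_colours_finite_card[OF X_def] by blast
  \<comment> \<open>An edge is a set and has to be oriented first; by symmetry of
    \<open>edge_colour\<close> the choice through \<open>Min\<close> and \<open>Max\<close> does not
    matter.\<close>
  define c where "c e = edge_colour t (p (Min e)) (p (Max e))" for e
  have c: "c {u, v} = edge_colour t (p u) (p v)" for u v
    using edge_colour_commute by (auto simp: c_def min_def max_def)
  have "2 ^ (n choose 2) \<le> max_code (complete_graph 5) n * (card C + 1) ^ (5 choose 2)"
  proof (rule max_code_complete_graph_ge[where c = c])
    show "finite C" by fact
    show "c e \<in> C" if e: "e \<in> [{1..n}]\<^bsup>2\<^esup>" for e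
    proof -
      obtain u v where "e = {u, v}" "u \<in> {1..n}" "v \<in> {1..n}" "u \<noteq> v"
        by (rule nsets2_E[OF e])
      then show ?thesis
        using C(3)[of "p u" "p v"] p by (simp add: c inj_on_eq_iff image_subset_iff)
    qed
    fix W assume W: "W \<subseteq> {1..n}" "card W = 5"
    have inj: "inj_on p W"
      using p(2) W(1) inj_on_subset by blast
    have "p ` W \<subseteq> extensional {..<t}"
      using image_mono[OF W(1), of p] p(1) unfolding X_def PiE_def by blast
    then obtain x y where "uniquely_coloured (edge_colour t) (p ` W) x y"
      using five_points_unique_colour[of "p ` W" t] W(2) by (auto simp: card_image[OF inj])
    then obtain u v where uv: "u \<in> W" "v \<in> W" "uniquely_coloured (edge_colour t) (p ` W) (p u) (p v)"
      unfolding uniquely_coloured_def by blast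
    have "e' = {u, v}" if e': "e' \<in> [W]\<^bsup>2\<^esup>" "c e' = c {u, v}" for e'
    proof -
      obtain a b where ab: "e' = {a, b}" "a \<in> W" "b \<in> W" "a \<noteq> b"
        by (rule nsets2_E[OF e'(1)])
      then have "p ` {a, b} = p ` {u, v}"
        using uv(3) e'(2) inj unfolding uniquely_coloured_def by (simp add: c inj_on_eq_iff)
      then show ?thesis
        using ab uv(1,2) inj_on_image_eq_iff[OF inj, of "{a, b}" "{u, v}"] by simp
    qed
    moreover have "{u, v} \<in> [W]\<^bsup>2\<^esup>"
      using uv unfolding uniquely_coloured_def by auto
    ultimately show "\<exists>e\<in>[W]\<^bsup>2\<^esup>. \<forall>e'\<in>[W]\<^bsup>2\<^esup>. c e' = c e \<longrightarrow> e' = e"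
      by blast
  qed
  also have "5 choose 2 = (10 :: nat)"
    by (simp add: choose_two)
  also have "(card C + 1) ^ 10 \<le> (t * (m\<^sup>2 * 3 ^ t) + 1) ^ 10"
    using C(2) by (intro power_mono) auto
  finally show ?thesis by simp
qed

text \<open>Take \<open>m = 2 ^ t\<close>. Bounding the factor \<open>t\<close> by
  \<open>2 ^ t\<close> gives at most \<open>(2 * 4 * 3) ^ t = 24 ^ t\<close> colours, and absorbing
  the added 1 costs another \<open>2 ^ t\<close>, hence 48. The exponent 10 is
  \<open>5 choose 2\<close>.\<close>

lemma code_density_K5_ge:
  assumes "n \<le> 2 ^ t\<^sup>2" "t > 0"
  shows "1 / 48 ^ (10 * t) \<le> code_density (complete_graph 5) n"
proof -
  have "t * ((2 ^ t)\<^sup>2 * 3 ^ t) + 1 \<le> 2 ^ t * ((2 ^ t)\<^sup>2 * 3 ^ t) + (1 :: nat)"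
    by (intro add_mono mult_mono) (auto intro: less_imp_le)
  also have "2 ^ t * ((2 ^ t)\<^sup>2 * 3 ^ t) = (24 :: nat) ^ t"
    by (simp add: power2_eq_square flip: power_mult_distrib)
  also have "24 ^ t + 1 \<le> (24 :: nat) ^ t * 2 ^ t"
  proof -
    have "24 ^ t * 2 \<le> (24 :: nat) ^ t * 2 ^ t"
      using assms(2) power_increasing[of 1 t "2 :: nat"] by simp
    then show ?thesis
      using one_le_power[of "24 :: nat" t] by linarith
  qed
  also have "\<dots> = 48 ^ t"
    by (simp flip: power_mult_distrib)
  finally have "(t * ((2 ^ t)\<^sup>2 * 3 ^ t) + 1) ^ 10 \<le> ((48 :: nat) ^ t) ^ 10"
    by (intro power_mono) auto
  moreover have "n \<le> (2 ^ t) ^ t"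
    using assms(1) by (simp add: power2_eq_square flip: power_mult)
  ultimately have "2 ^ (n choose 2) \<le> max_code (complete_graph 5) n * ((48 :: nat) ^ t) ^ 10"
    using max_code_K5_ge[of n "2 ^ t" t] by (meson le_trans mult_le_mono2)
  then have "real (2 ^ (n choose 2)) \<le> real (max_code (complete_graph 5) n * 48 ^ (10 * t))"
    unfolding of_nat_le_iff by (simp add: mult.commute flip: power_mult)
  then show ?thesis
    by (simp add: code_density_def field_simps)
qed

text \<open>The choice of parameters for the general bound relies on \<open>log 2 n > 0\<close>. For
  these \<open>n\<close> the code whose only member is the empty graph is enough.\<close>

lemma code_density_at_most_one_vertex:
  assumes "n \<le> 1"
  shows "1 \<le> code_density H n"
proof -
  have "1 \<le> max_code H n"
    using card_le_max_code[of H n "{{}}"] by (simp add: graph_code_def)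
  moreover have "n choose 2 = 0"
    using assms by (simp add: binomial_eq_0)
  ultimately show ?thesis
    unfolding code_density_def by (simp only: power_0 div_by_1 of_nat_1 flip: of_nat_le_iff)
qed

theorem theorem2:
  shows "\<exists>\<epsilon> :: nat \<Rightarrow> real. \<epsilon> \<longlonglongrightarrow> 0 \<and>
    (\<forall>n. code_density (complete_graph 5) n \<ge> real n powr (- \<epsilon> n))"
proof -
  \<comment> \<open>For \<open>n > 1\<close> this makes \<open>n powr (- \<epsilon> n)\<close> equal
    to 48 to the power \<open>-10 * (sqrt (log 2 n) + 1)\<close>; the \<open>+ 1\<close> pays for
    rounding up \<open>t\<close>.\<close>
  define \<epsilon> :: "nat \<Rightarrow> real" where "\<epsilon> n = 10 * (sqrt (log 2 n) + 1) * ln 48 / ln n" for n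
  have "\<epsilon> \<longlonglongrightarrow> 0"
    unfolding \<epsilon>_def by real_asymp
  moreover have "code_density (complete_graph 5) n \<ge> real n powr (- \<epsilon> n)" for n
  proof (cases "n \<le> 1")
    case True
    \<comment> \<open>Whatever the exponent, \<open>powr\<close> gives 0 for base 0 and 1 for base
      1.\<close>
    then have "real n powr (- \<epsilon> n) \<le> 1"
      by (cases n) auto
    then show ?thesis
      using code_density_at_most_one_vertex[OF True] by (rule order_trans)
  next
    case False
    \<comment> \<open>The least \<open>t\<close> whose square reaches \<open>log 2 n\<close>, so
      that \<open>2 ^ t\<^sup>2\<close> words suffice for \<open>n\<close> vertices.\<close>
    define t where "t = nat \<lceil>sqrt (log 2 n)\<rceil>"
    have "log 2 n > 0"
      using False by simp
    then have "t > 0" "real t \<le> sqrt (log 2 n) + 1" "sqrt (log 2 n) \<le> real t"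
      unfolding t_def by (auto simp: le_of_int_ceiling)
    have "log 2 n = (sqrt (log 2 n))\<^sup>2"
      using \<open>log 2 n > 0\<close> by simp
    also have "\<dots> \<le> (real t)\<^sup>2"
      using \<open>sqrt (log 2 n) \<le> real t\<close> \<open>log 2 n > 0\<close> by (intro power_mono) auto
    finally have "log 2 n \<le> real (t\<^sup>2)"
      by simp
    then have "real n \<le> 2 powr real (t\<^sup>2)"
      using False by (subst (asm) log_le_iff) auto
    also have "\<dots> = real (2 ^ t\<^sup>2)"
      by (subst powr_realpow) simp_all
    finally have "n \<le> 2 ^ t\<^sup>2"
      by (simp only: of_nat_le_iff)
    have "real n powr (- \<epsilon> n) = exp (- (10 * (sqrt (log 2 n) + 1) * ln 48))"
      using False by (simp add: powr_def \<epsilon>_def)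
    also have "\<dots> \<le> exp (- (10 * real t * ln 48))"
      using \<open>real t \<le> sqrt (log 2 n) + 1\<close> by simp
    also have "\<dots> = 1 / 48 ^ (10 * t)"
      by (simp add: exp_minus inverse_eq_divide ln_realpow flip: powr_realpow) (simp add: powr_def)
    also have "\<dots> \<le> code_density (complete_graph 5) n"
      by (rule code_density_K5_ge) fact+
    finally show ?thesis .
  qed
  ultimately show ?thesis by blast
qed

end
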